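(* Suppose that $\pi_\Psi$ is positive and continuous and that we have a regular discretization $\{B_\lambda(\psi):\psi\in\Psi\}$, $\lambda>0$, of $\Psi$. Further suppose that, for every $x$, $\psi_{\mathrm{LRSE}}(x)$ is the unique maximizer of $\psi\mapsto\pi_\Psi(\psi\,|\,x)/\pi_\Psi(\psi)$ and, for any $\epsilon>0$, $$\sup_{\{\psi:\|\psi-\psi_{\mathrm{LRSE}}(x)\|\geq\epsilon\}}\frac{\pi_\Psi(\psi\,|\,x)}{\pi_\Psi(\psi)}<\frac{\pi_\Psi(\psi_{\mathrm{LRSE}}(x)\,|\,x)}{\pi_\Psi(\psi_{\mathrm{LRSE}}(x))}.$$ Then there exists $\eta(\lambda)>0$ (a positive function of $\lambda>0$ alone) such that a Bayes rule $\delta_{\lambda,\eta(\lambda)}$ for the discretized problem with loss $L_{\lambda,\eta(\lambda)}$ satisfies $\delta_{\lambda,\eta(\lambda)}(x)\to\psi_{\mathrm{LRSE}}(x)$ as $\lambda\to0$, for all $x$.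
   Context: Setting: $\{f_\theta:\theta\in\Theta\}$ is a family of probability densities with respect to a support measure $\mu$ on a sample space $\mathcal X$. $\Pi$ is a proper prior (probability measure) on $\Theta$ with density $\pi$ with respect to a support measure $\nu$. Put $m(x)=\int_\Theta \pi(\theta)f_\theta(x)\,\nu(d\theta)$. The posterior $\Pi(\cdot\,|\,x)$ has density $\pi(\theta\,|\,x)=\pi(\theta)f_\theta(x)/m(x)$ with respect to $\nu$. A map $\Psi:\Theta\to\Psi$ is given; the same symbol $\Psi$ denotes the map and its target space. $\Pi_\Psi$ and $\Pi_\Psi(\cdot\,|\,x)$ are the marginal prior and marginal posterior of $\psi=\Psi(\theta)$, with densities $\pi_\Psi$ and $\pi_\Psi(\cdot\,|\,x)$ with respect to a support measure $\nu_\Psi$ on $\Psi$. All spaces are open subsets of Euclidean spaces, the support measures are Euclidean volume on these sets, and mappings are assumed to be sufficiently smooth. $I(\cdot)$ is the indicator. $\psi_{\mathrm{LRSE}}(x)$ (least relative surprise estimator) denotes the maximizer over $\psi\in\Psi$ of $\pi_\Psi(\psi\,|\,x)/\pi_\Psi(\psi)$. Regular discretization: for each $\lambda>0$, $\{B_\lambda(\psi):\psi\in\Psi\}$ is a countable partition of $\Psi$ with $\psi\in B_\lambda(\psi)$ and $\Pi_\Psi(B_\lambda(\psi))>0$ (so $B_\lambda(\psi)$ is the cell containing $\psi$); $\sup_{\psi\in\Psi}\mathrm{diam}(B_\lambda(\psi))\to0$ as $\lambda\to0$; and $\Pi_\Psi(B_\lambda(\psi))/\nu_\Psi(B_\lambda(\psi))\to\pi_\Psi(\psi)$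 as $\lambda\to0$ for every $\psi$. One point $\psi_\lambda(\psi)\in B_\lambda(\psi)$ is chosen in each cell, so that $\psi_\lambda(\psi')=\psi_\lambda(\psi)$ whenever $\psi'\in B_\lambda(\psi)$, and $\Psi_\lambda=\{\psi_\lambda(\psi):\psi\in\Psi\}$. The discretized prior and posterior on $\Psi_\lambda$ are $\pi_{\Psi,\lambda}(\psi_\lambda(\psi))=\Pi_\Psi(B_\lambda(\psi))$ and $\pi_{\Psi,\lambda}(\psi_\lambda(\psi)\,|\,x)=\Pi_\Psi(B_\lambda(\psi)\,|\,x)$. For $\lambda,\eta>0$ the loss function of the discretized problem, with action space $\Psi_\lambda$, is $$L_{\lambda,\eta}(\theta,\psi_\lambda(\psi))=\frac{I(\psi_\lambda(\Psi(\theta))\neq\psi_\lambda(\psi))}{\max(\eta,\pi_{\Psi,\lambda}(\psi_\lambda(\Psi(\theta))))}.$$ $\delta_{\lambda,\eta}$ denotes a Bayes rule for this problem: for each $x$, $\delta_{\lambda,\eta}(x)\in\Psi_\lambda$ minimizes over $a\in\Psi_\lambda$ the posterior risk $\int_\Theta L_{\lambda,\eta}(\theta,a)\pi(\theta\,|\,x)\,\nu(d\theta)$ (and hence the rule minimizes the prior risk). *)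

theory Defs
  imports "HOL-Probability.Probability"
begin

definition volume_on :: "'a::euclidean_space set \<Rightarrow> 'a measure" where
  "volume_on S = restrict_space lborel S"

definition prior_measure :: "'t::euclidean_space set \<Rightarrow> ('t \<Rightarrow> real) \<Rightarrow> 't measure" where
  "prior_measure \<Theta> p = density (volume_on \<Theta>) (\<lambda>\<theta>. ennreal (p \<theta>))"

definition prior_predictive ::
  "'t::euclidean_space set \<Rightarrow> ('t \<Rightarrow> real) \<Rightarrow> ('t \<Rightarrow> 'x \<Rightarrow> real) \<Rightarrow> 'x \<Rightarrow> real" where
  "prior_predictive \<Theta> p f x = (\<integral>\<theta>. p \<theta> * f \<theta> x \<partial>volume_on \<Theta>)"

definition posterior_density ::
  "'t::euclidean_space set \<Rightarrow> ('t \<Rightarrow> real) \<Rightarrow> ('t \<Rightarrow> 'x \<Rightarrow> real) \<Rightarrow> 'x \<Rightarrow> 't \<Rightarrow> real" where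
  "posterior_density \<Theta> p f x \<theta> = p \<theta> * f \<theta> x / prior_predictive \<Theta> p f x"

definition posterior_measure ::
  "'t::euclidean_space set \<Rightarrow> ('t \<Rightarrow> real) \<Rightarrow> ('t \<Rightarrow> 'x \<Rightarrow> real) \<Rightarrow> 'x \<Rightarrow> 't measure" where
  "posterior_measure \<Theta> p f x =
     density (volume_on \<Theta>) (\<lambda>\<theta>. ennreal (posterior_density \<Theta> p f x \<theta>))"

text \<open>
  The last conjunct says that the posterior is defined at every \<open>x\<close>. It also yields
  integrability of \<open>\<theta> \<mapsto> p \<theta> * f \<theta> x\<close>, because the Bochner integral of a non-integrable
  function is 0.
\<close>

definition bayes_model ::
  "'t::euclidean_space set \<Rightarrow> 'x::euclidean_space set \<Rightarrow> ('t \<Rightarrow> 'x \<Rightarrow> real) \<Rightarrow> ('t \<Rightarrow> real) \<Rightarrow> bool"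
  where
  "bayes_model \<Theta> X f p \<longleftrightarrow>
     open \<Theta> \<and> open X \<and>
     case_prod f \<in> borel_measurable (volume_on \<Theta> \<Otimes>\<^sub>M volume_on X) \<and>
     (\<forall>\<theta>\<in>\<Theta>. \<forall>x\<in>X. 0 \<le> f \<theta> x) \<and>
     (\<forall>\<theta>\<in>\<Theta>. prob_space (density (volume_on X) (\<lambda>x. ennreal (f \<theta> x)))) \<and>
     p \<in> borel_measurable (volume_on \<Theta>) \<and>
     (\<forall>\<theta>\<in>\<Theta>. 0 \<le> p \<theta>) \<and>
     prob_space (prior_measure \<Theta> p) \<and>
     (\<forall>x\<in>X. 0 < prior_predictive \<Theta> p f x)"

definition marginal :: "'t measure \<Rightarrow> 'p::euclidean_space set \<Rightarrow> ('t \<Rightarrow> 'p) \<Rightarrow> 'p measure" where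
  "marginal M S \<psi> = distr M (volume_on S) \<psi>"

text \<open>
  Nonnegativity has to be required separately, since \<open>ennreal\<close> maps negative numbers to 0.
  The library predicate \<open>distributed\<close> includes measurability of the map \<open>\<psi>\<close> into \<open>S\<close> and of
  the density \<open>g\<close>.
\<close>

definition marginal_density ::
  "'t measure \<Rightarrow> 'p::euclidean_space set \<Rightarrow> ('t \<Rightarrow> 'p) \<Rightarrow> ('p \<Rightarrow> real) \<Rightarrow> bool" where
  "marginal_density M S \<psi> g \<longleftrightarrow>
     distributed M (volume_on S) \<psi> (\<lambda>y. ennreal (g y)) \<and> (\<forall>y\<in>S. 0 \<le> g y)"

definition relative_belief :: "('p \<Rightarrow> real) \<Rightarrow> ('x \<Rightarrow> 'p \<Rightarrow> real) \<Rightarrow> 'x \<Rightarrow> 'p \<Rightarrow> real" where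
  "relative_belief r q x y = q x y / r y"

definition lrse :: "'p set \<Rightarrow> ('p \<Rightarrow> real) \<Rightarrow> ('x \<Rightarrow> 'p \<Rightarrow> real) \<Rightarrow> 'x \<Rightarrow> 'p" where
  "lrse S r q x = arg_max_on (relative_belief r q x) S"

text \<open>
  The library's real-valued \<open>diameter\<close> is unspecified on unbounded sets; cells may be unbounded
  for large \<open>l\<close>, so diameters are taken in the extended reals.
\<close>

definition ediameter :: "'p::metric_space set \<Rightarrow> ereal" where
  "ediameter A = (SUP (y, z)\<in>A \<times> A. ereal (dist y z))"

text \<open>
  In the last conjunct a cell of infinite volume gives the ratio 0 under the convention
  \<open>a / 0 = 0\<close>; by the diameter condition no such cell occurs for small \<open>l\<close>.
\<close>

definition regular_discretization ::
  "'p::euclidean_space set \<Rightarrow> 'p measure \<Rightarrow> ('p \<Rightarrow> real) \<Rightarrow> (real \<Rightarrow> 'p \<Rightarrow> 'p set) \<Rightarrow> bool" where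
  "regular_discretization S P r B \<longleftrightarrow>
     (\<forall>l>0. countable (B l ` S) \<and> partition_on S (B l ` S) \<and>
        (\<forall>y\<in>S. y \<in> B l y \<and> B l y \<in> sets (volume_on S) \<and> 0 < measure P (B l y))) \<and>
     ((\<lambda>l. SUP y\<in>S. ediameter (B l y)) \<longlongrightarrow> 0) (at_right 0) \<and>
     (\<forall>y\<in>S. ((\<lambda>l. measure P (B l y) / measure (volume_on S) (B l y)) \<longlongrightarrow> r y) (at_right 0))"

definition cell_representatives ::
  "'p set \<Rightarrow> (real \<Rightarrow> 'p \<Rightarrow> 'p set) \<Rightarrow> (real \<Rightarrow> 'p \<Rightarrow> 'p) \<Rightarrow> bool" where
  "cell_representatives S B rep \<longleftrightarrow>
     (\<forall>l>0. \<forall>y\<in>S. rep l y \<in> B l y \<and> (\<forall>z\<in>B l y. rep l z = rep l y))"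

text \<open>
  Meant for representatives \<open>a\<close>: the cell of \<open>rep l y\<close> is the cell of \<open>y\<close>, so the value at
  \<open>rep l y\<close> is the probability of \<open>B l y\<close>.
\<close>

definition discrete_prior :: "'p measure \<Rightarrow> (real \<Rightarrow> 'p \<Rightarrow> 'p set) \<Rightarrow> real \<Rightarrow> 'p \<Rightarrow> real" where
  "discrete_prior P B l a = measure P (B l a)"

definition discrete_loss ::
  "('t \<Rightarrow> 'p) \<Rightarrow> 'p measure \<Rightarrow> (real \<Rightarrow> 'p \<Rightarrow> 'p set) \<Rightarrow> (real \<Rightarrow> 'p \<Rightarrow> 'p) \<Rightarrow>
     real \<Rightarrow> real \<Rightarrow> 't \<Rightarrow> 'p \<Rightarrow> real" where
  "discrete_loss \<psi> P B rep l e \<theta> a =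
     of_bool (rep l (\<psi> \<theta>) \<noteq> a) / max e (discrete_prior P B l (rep l (\<psi> \<theta>)))"

definition posterior_risk ::
  "'t::euclidean_space set \<Rightarrow> ('t \<Rightarrow> 'x \<Rightarrow> real) \<Rightarrow> ('t \<Rightarrow> real) \<Rightarrow> ('t \<Rightarrow> 'a \<Rightarrow> real) \<Rightarrow>
     'x \<Rightarrow> 'a \<Rightarrow> real" where
  "posterior_risk \<Theta> f p L x a =
     (\<integral>\<theta>. L \<theta> a * posterior_density \<Theta> p f x \<theta> \<partial>volume_on \<Theta>)"

definition bayes_rule ::
  "'t::euclidean_space set \<Rightarrow> 'x set \<Rightarrow> ('t \<Rightarrow> 'x \<Rightarrow> real) \<Rightarrow> ('t \<Rightarrow> real) \<Rightarrow>
     'a set \<Rightarrow> ('t \<Rightarrow> 'a \<Rightarrow> real) \<Rightarrow> ('x \<Rightarrow> 'a) \<Rightarrow> bool" where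
  "bayes_rule \<Theta> X f p A L d \<longleftrightarrow>
     (\<forall>x\<in>X. is_arg_min (posterior_risk \<Theta> f p L x) (\<lambda>a. a \<in> A) (d x))"

end

theory Submission
  imports Defs
begin

text \<open>
  Write \<open>P\<close> and \<open>Q\<close> for the prior and posterior distributions of \<open>\<psi>\<close> (with \<open>Q\<close> depending on
  the data \<open>x\<close>). A wrong guess costs \<open>1 / max \<eta> (P C)\<close>, where \<open>C\<close> is the cell containing the true
  value of \<open>\<psi>\<close>, and a right guess costs nothing. So the posterior risk of guessing the cell \<open>D\<close>
  equals a constant minus \<open>Q D / max \<eta> (P D)\<close> (lemma \<open>posterior_risk_split\<close>), and a Bayes rule
  selects a cell that maximizes this truncated ratio. For each fixed \<open>\<eta> > 0\<close> a maximum is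
  attained, because only finitely many disjoint cells can have large posterior probability
  (lemma \<open>exists_max_truncated_ratio\<close>).

  Without truncation, \<open>Q D / P D\<close> is a weighted mean over \<open>D\<close> of the ratio of densities \<open>q / r\<close>.
  Let \<open>y\<close> be its maximizer. Cells are small in the limit, so the separation hypothesis gives a bound
  \<open>s < q y / r y\<close> for the ratio on all cells that are not close to \<open>y\<close>, and truncation only lowers
  these values further. Continuity gives a ratio of at least some \<open>c > s\<close> on every
  cell sufficiently near \<open>y\<close>. It therefore suffices that at least one such cell is not affected by
  the truncation, that is, has prior probability at least \<open>\<eta>\<close>.

  The threshold must not depend on \<open>x\<close>, hence not on \<open>y\<close>. Demanding that the cell of every \<open>y\<close>
  eventually has mass at least \<open>\<eta> l\<close> would ask too much: with infinitely many cells near each point,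
  the masses of the cells around uncountably many points need not admit a common eventual lower
  bound. What is needed is only that some cell \<^emph>\<open>near\<close> \<open>y\<close> is heavy enough, and
  for this a countable dense set of points is enough: \<open>\<eta> l\<close> is the least mass among the cells of
  the first \<open>\<lfloor>1 / l\<rfloor> + 1\<close> of these points, so each dense point is taken into account for all
  small \<open>l\<close> (lemma \<open>exists_mass_floor_near_every_point\<close>).
\<close>

section \<open>A threshold that does not depend on the data\<close>

text \<open>
  A diagonal choice: \<open>\<eta> l\<close> has to respect only finitely many members of a dense sequence for each
  \<open>l\<close>, and each member is respected from some \<open>l\<close> on. The quantity \<open>g l z\<close> stands for the mass of
  the cell of \<open>z\<close>.
\<close>

lemma exists_mass_floor_near_every_point:
  fixes S :: "'p::euclidean_space set" and g :: "real \<Rightarrow> 'p \<Rightarrow> real"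
  assumes pos: "\<And>l y. 0 < l \<Longrightarrow> y \<in> S \<Longrightarrow> 0 < g l y"
  shows "\<exists>\<eta> :: real \<Rightarrow> real. (\<forall>l>0. 0 < \<eta> l) \<and>
    (\<forall>y\<in>S. \<forall>e>0. eventually (\<lambda>l. \<exists>z\<in>S. dist z y < e \<and> \<eta> l \<le> g l z) (at_right 0))"
proof (cases "S = {}")
  case True
  then show ?thesis by (intro exI[of _ "\<lambda>_. 1"]) auto
next
  case False
  obtain D where D: "countable D" "D \<subseteq> S" "S \<subseteq> closure D"
    using separable by blast
  with False have "D \<noteq> {}" by auto
  define z where "z = from_nat_into D"
  have z: "range z = D" unfolding z_def using D \<open>D \<noteq> {}\<close> by (simp add: range_from_nat_into)
  define \<eta> where "\<eta> l = Min ((\<lambda>k. g l (z k)) ` {..nat \<lfloor>1 / l\<rfloor>})" for l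
  show ?thesis
  proof (intro exI[of _ \<eta>] conjI allI ballI impI)
    fix l :: real assume "0 < l"
    then show "0 < \<eta> l" unfolding \<eta>_def using z D pos by (subst Min_gr_iff) auto
  next
    fix y e assume y: "y \<in> S" and e: "0 < (e::real)"
    then obtain d where "d \<in> D" "dist d y < e"
      using D by (meson closure_approachable subsetD)
    then obtain k where k: "dist (z k) y < e" using z by auto
    have "eventually (\<lambda>l::real. l \<in> {0<..<1 / real (Suc k)}) (at_right 0)"
      by (intro eventually_at_right_real) simp
    then show "eventually (\<lambda>l. \<exists>z\<in>S. dist z y < e \<and> \<eta> l \<le> g l z) (at_right 0)"
    proof eventually_elim
      case (elim l)
      then have "real k \<le> 1 / l" by (simp add: field_simps)
      then have "k \<le> nat \<lfloor>1 / l\<rfloor>" by (simp add: le_nat_floor)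
      then have "\<eta> l \<le> g l (z k)" unfolding \<eta>_def by (intro Min_le) auto
      moreover have "z k \<in> S" using z D by auto
      ultimately show ?case using k by blast
    qed
  qed
qed

section \<open>Existence of a best cell\<close>

lemma finite_cells_of_large_measure:
  assumes "finite_measure M" "disjoint \<C>" "\<C> \<subseteq> sets M" "0 < (v::real)"
  shows "finite {C \<in> \<C>. v \<le> measure M C}"
proof (rule ccontr)
  interpret finite_measure M by fact
  let ?F = "{C \<in> \<C>. v \<le> measure M C}"
  assume "infinite ?F"
  obtain n :: nat where n: "measure M (space M) < real n * v"
    using reals_Archimedean3[OF \<open>0 < v\<close>] by blast
  obtain T where T: "finite T" "card T = n" "T \<subseteq> ?F"
    using infinite_arbitrarily_large[OF \<open>infinite ?F\<close>] by blast
  have "real n * v = (\<Sum>C\<in>T. v)" using T by simp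
  also have "\<dots> \<le> (\<Sum>C\<in>T. measure M C)" using T by (intro sum_mono) auto
  also have "\<dots> = measure M (\<Union>C\<in>T. C)"
    using T assms by (intro finite_measure_finite_Union[symmetric])
      (auto simp: disjoint_family_on_def pairwise_def disjnt_def)
  also have "\<dots> \<le> measure M (space M)" by (rule bounded_measure)
  finally show False using n by simp
qed

text \<open>
  Reaching a given positive value of the truncated ratio forces the measure of a cell to be at least
  that value times \<open>e\<close>, so all but finitely many cells fall below the value of one fixed cell.
\<close>

lemma exists_max_truncated_ratio:
  assumes "finite_measure M" "disjoint \<C>" "\<C> \<subseteq> sets M" "\<C> \<noteq> {}" "0 < (e::real)"
  shows "\<exists>C\<in>\<C>. \<forall>D\<in>\<C>. measure M D / max e (w D) \<le> measure M C / max e (w C)"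
proof -
  define H where "H C = measure M C / max e (w C)" for C
  have H_le: "e * H C \<le> measure M C" for C
  proof -
    have "e * measure M C \<le> max e (w C) * measure M C" by (intro mult_right_mono) auto
    then show ?thesis unfolding H_def using \<open>0 < e\<close> by (simp add: field_simps)
  qed
  have H_nonneg: "0 \<le> H C" for C unfolding H_def using \<open>0 < e\<close> by simp
  show ?thesis
  proof (cases "\<exists>C\<in>\<C>. 0 < H C")
    case False
    moreover obtain C where "C \<in> \<C>" using assms by blast
    ultimately show ?thesis unfolding H_def[symmetric] by (meson H_nonneg linorder_not_less order_trans)
  next
    case True
    then obtain C0 where C0: "C0 \<in> \<C>" "0 < H C0" by blast
    define F where "F = {C \<in> \<C>. e * H C0 \<le> measure M C}"
    \<comment> \<open>Outside \<open>F\<close> every cell has a ratio below that of \<open>C0\<close>.\<close>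
    have "finite F" unfolding F_def
      using assms C0 by (intro finite_cells_of_large_measure) auto
    moreover have "C0 \<in> F" unfolding F_def using C0 H_le by auto
    ultimately have "Max (H ` F) \<in> H ` F" by (intro Max_in) auto
    then obtain C where "C \<in> F" "H C = Max (H ` F)" by auto
    then have C: "C \<in> F" "\<And>D. D \<in> F \<Longrightarrow> H D \<le> H C" using \<open>finite F\<close> by auto
    have "H D \<le> H C" if D: "D \<in> \<C>" for D
    proof (cases "D \<in> F")
      case False
      then have "e * H D \<le> e * H C0" using D H_le[of D] unfolding F_def by auto
      then show ?thesis using C(2)[OF \<open>C0 \<in> F\<close>] \<open>0 < e\<close> by auto
    qed (use C in auto)
    then show ?thesis using C(1) unfolding F_def H_def by blast
  qed
qed

section \<open>Comparison of measures through their densities\<close>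

text \<open>
  Used in both directions: an upper bound for the ratio of densities on a cell bounds the
  posterior probability of the cell above, and a lower bound \<open>c\<close> for the ratio is the same
  statement with the roles of prior and posterior exchanged and \<open>s = 1 / c\<close>.
\<close>

lemma measure_density_le_mult:
  fixes f g :: "'a \<Rightarrow> real"
  assumes P: "P = density N (\<lambda>y. ennreal (f y))" and Q: "Q = density N (\<lambda>y. ennreal (g y))"
    and fin: "finite_measure P" "finite_measure Q"
    and meas: "(\<lambda>y. ennreal (f y)) \<in> borel_measurable N" "(\<lambda>y. ennreal (g y)) \<in> borel_measurable N"
    and A: "A \<in> sets N" and "0 \<le> s" and le: "\<And>y. y \<in> A \<Longrightarrow> g y \<le> s * f y"
  shows "measure Q A \<le> s * measure P A"
proof -
  interpret P: finite_measure P by fact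
  interpret Q: finite_measure Q by fact
  have "emeasure Q A = (\<integral>\<^sup>+ y. ennreal (g y) * indicator A y \<partial>N)"
    unfolding Q using meas A by (subst emeasure_density) auto
  also have "\<dots> \<le> (\<integral>\<^sup>+ y. ennreal s * (ennreal (f y) * indicator A y) \<partial>N)"
    using le \<open>0 \<le> s\<close>
    by (intro nn_integral_mono) (auto simp: indicator_def ennreal_mult'[symmetric] intro: ennreal_leI)
  also have "\<dots> = ennreal s * (\<integral>\<^sup>+ y. ennreal (f y) * indicator A y \<partial>N)"
    using meas A by (intro nn_integral_cmult) auto
  also have "\<dots> = ennreal s * emeasure P A"
    unfolding P using meas A by (subst emeasure_density) auto
  finally show ?thesis
    using \<open>0 \<le> s\<close> by (simp add: P.emeasure_eq_measure Q.emeasure_eq_measure ennreal_mult'[symmetric])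
qed

section \<open>The posterior as a probability measure\<close>

lemma posterior_density_measurable:
  assumes "bayes_model \<Theta> X f p" "x \<in> X"
  shows "posterior_density \<Theta> p f x \<in> borel_measurable (volume_on \<Theta>)"
proof -
  have "case_prod f \<in> borel_measurable (volume_on \<Theta> \<Otimes>\<^sub>M volume_on X)"
    "p \<in> borel_measurable (volume_on \<Theta>)"
    using assms unfolding bayes_model_def by auto
  moreover have "x \<in> space (volume_on X)"
    using assms by (simp add: volume_on_def space_restrict_space)
  ultimately have "(\<lambda>\<theta>. case_prod f (\<theta>, x)) \<in> borel_measurable (volume_on \<Theta>)"
    by (intro measurable_compose[OF measurable_Pair2']) auto
  then show ?thesis
    unfolding posterior_density_def using \<open>p \<in> _\<close> by simp
qed

lemma posterior_density_nonneg:
  assumes "bayes_model \<Theta> X f p" "x \<in> X" "\<theta> \<in> \<Theta>"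
  shows "0 \<le> posterior_density \<Theta> p f x \<theta>"
  using assms unfolding bayes_model_def posterior_density_def
  by (auto intro!: divide_nonneg_pos mult_nonneg_nonneg)

lemma prob_space_posterior:
  assumes model: "bayes_model \<Theta> X f p" and x: "x \<in> X"
  shows "prob_space (posterior_measure \<Theta> p f x)"
proof
  let ?d = "posterior_density \<Theta> p f x"
  have m: "0 < prior_predictive \<Theta> p f x" using assms unfolding bayes_model_def by auto
  \<comment> \<open>The integral of a non-integrable function is \<open>0\<close>, but the prior predictive density is positive.\<close>
  then have "integrable (volume_on \<Theta>) (\<lambda>\<theta>. p \<theta> * f \<theta> x)"
    unfolding prior_predictive_def using not_integrable_integral_eq by fastforce
  then have int: "integrable (volume_on \<Theta>) ?d"
    unfolding posterior_density_def by simp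
  have one: "(\<integral>\<theta>. ?d \<theta> \<partial>volume_on \<Theta>) = 1"
    unfolding posterior_density_def using m by (simp add: prior_predictive_def)
  have sp: "space (volume_on \<Theta>) = \<Theta>" by (simp add: volume_on_def space_restrict_space)
  have "emeasure (posterior_measure \<Theta> p f x) (space (posterior_measure \<Theta> p f x))
      = (\<integral>\<^sup>+ \<theta>. ennreal (?d \<theta>) \<partial>volume_on \<Theta>)"
    unfolding posterior_measure_def using posterior_density_measurable[OF assms]
    by (auto simp: emeasure_density intro!: nn_integral_cong)
  also have "\<dots> = 1"
    using int one posterior_density_nonneg[OF assms] sp
    by (subst nn_integral_eq_integral) auto
  finally show "emeasure (posterior_measure \<Theta> p f x) (space (posterior_measure \<Theta> p f x)) = 1" .
qed

section \<open>The posterior risk of a cell\<close>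

lemma measurable_const_on_countable_cells:
  assumes \<C>: "countable \<C>" "\<C> \<subseteq> sets N" "\<Union>\<C> = space N"
    and const: "\<And>C y z. C \<in> \<C> \<Longrightarrow> y \<in> C \<Longrightarrow> z \<in> C \<Longrightarrow> h y = (h z :: real)"
  shows "h \<in> borel_measurable N"
proof (rule measurable_piecewise_restrict[OF \<C>(1)])
  fix C assume C: "C \<in> \<C>"
  then show "C \<inter> space N \<in> sets N" using \<C> by auto
  obtain c where "\<And>y. y \<in> C \<Longrightarrow> h y = c" using const[OF C] by metis
  then show "h \<in> measurable (restrict_space N C) borel"
    by (subst measurable_cong[of _ _ "\<lambda>_. c"]) (auto simp: space_restrict_space)
qed (use \<C> in auto)

text \<open>
  One discretization at a fixed level; the level is suppressed in \<open>B\<close> and \<open>rep\<close>.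
\<close>

locale cell_partition =
  fixes S :: "'p::euclidean_space set" and B :: "'p \<Rightarrow> 'p set" and rep :: "'p \<Rightarrow> 'p"
  assumes countable_cells: "countable (B ` S)" and partition: "partition_on S (B ` S)"
    and in_cell: "y \<in> S \<Longrightarrow> y \<in> B y" and cell_sets: "y \<in> S \<Longrightarrow> B y \<in> sets (volume_on S)"
    and rep_in: "y \<in> S \<Longrightarrow> rep y \<in> B y"
    and rep_cong: "y \<in> S \<Longrightarrow> z \<in> B y \<Longrightarrow> rep z = rep y"
begin

lemma cell_subset: "y \<in> S \<Longrightarrow> B y \<subseteq> S"
  using partition by (auto simp: partition_on_def)

lemma cell_eq:
  assumes "y \<in> S" "z \<in> B y"
  shows "B z = B y"
proof -
  have z: "z \<in> S" "z \<in> B z" using assms cell_subset in_cell by blast+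
  then show ?thesis
    using partition assms unfolding partition_on_def disjoint_def by blast
qed

lemma rep_cell: "y \<in> S \<Longrightarrow> rep y \<in> S \<and> B (rep y) = B y"
  using rep_in cell_eq cell_subset by blast

lemma rep_eq_iff:
  assumes "a \<in> rep ` S" "y \<in> S"
  shows "rep y = a \<longleftrightarrow> y \<in> B a"
proof -
  obtain z where z: "z \<in> S" "a = rep z" using assms by auto
  then have "B a = B z" using rep_cell by auto
  then show ?thesis using z assms rep_cong in_cell rep_cell by metis
qed

text \<open>
  The loss is the penalty \<open>1 / max e (P C)\<close> of the true cell \<open>C\<close>, refunded if the guess \<open>a\<close> lies
  in \<open>C\<close>; in that case the penalty can be expressed through the cell of \<open>a\<close> alone. The discrete
  loss expects families indexed by the level, which are constant here.
\<close>

lemma discrete_loss_split: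
  assumes a: "a \<in> rep ` S" and y: "\<psi> \<theta> \<in> S"
  shows "discrete_loss \<psi> P (\<lambda>_. B) (\<lambda>_. rep) l e \<theta> a =
    1 / max e (measure P (B (\<psi> \<theta>))) - indicator (B a) (\<psi> \<theta>) / max e (measure P (B a))"
proof -
  have "B (rep (\<psi> \<theta>)) = B (\<psi> \<theta>)" using rep_cell y by blast
  moreover have "B a = B (\<psi> \<theta>)" if "\<psi> \<theta> \<in> B a"
    using rep_eq_iff[OF a y] that calculation by auto
  ultimately show ?thesis
    unfolding discrete_loss_def discrete_prior_def
    using rep_eq_iff[OF a y] by (auto simp: indicator_def)
qed

text \<open>
  Integrating the split loss, the penalty term contributes a constant \<open>K\<close> that is the same for all
  actions. It is finite because the penalty is bounded by \<open>1 / e\<close>; without the truncation it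
  could be infinite, being the sum of \<open>Q C / P C\<close> over all cells \<open>C\<close>.
\<close>

lemma posterior_risk_split:
  assumes model: "bayes_model \<Theta> X f p" and x: "x \<in> X" and e: "0 < e"
    and \<psi>: "\<psi> \<in> measurable (posterior_measure \<Theta> p f x) (volume_on S)"
  shows "\<exists>K. \<forall>a\<in>rep ` S.
    posterior_risk \<Theta> f p (discrete_loss \<psi> P (\<lambda>_. B) (\<lambda>_. rep) l e) x a =
      K - measure (marginal (posterior_measure \<Theta> p f x) S \<psi>) (B a) / max e (measure P (B a))"
proof -
  let ?M = "posterior_measure \<Theta> p f x" and ?V = "volume_on \<Theta>"
  interpret M: prob_space ?M by (rule prob_space_posterior[OF model x])
  define h where "h y = 1 / max e (measure P (B y))" for y
  have spV: "space ?V = \<Theta>" "space ?M = \<Theta>" and spS: "space (volume_on S) = S"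
    by (simp_all add: volume_on_def space_restrict_space posterior_measure_def)
  have h: "h \<in> borel_measurable (volume_on S)"
  proof (rule measurable_const_on_countable_cells[OF countable_cells])
    show "\<Union> (B ` S) = space (volume_on S)" using partition spS by (simp add: partition_on_def)
    show "h y = h z" if "C \<in> B ` S" "y \<in> C" "z \<in> C" for C y z
      using that cell_eq unfolding h_def by auto
  qed (use cell_sets in auto)
  have h_int: "integrable ?M (\<lambda>\<theta>. h (\<psi> \<theta>))"
  proof (rule M.integrable_const_bound[where B = "1 / e"])
    show "(\<lambda>\<theta>. h (\<psi> \<theta>)) \<in> borel_measurable ?M" using h \<psi> by measurable
    show "AE \<theta> in ?M. norm (h (\<psi> \<theta>)) \<le> 1 / e"
      using e unfolding h_def by (intro AE_I2) (auto simp: abs_le_iff intro!: divide_left_mono)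
  qed
  show ?thesis
  proof (intro exI[of _ "\<integral>\<theta>. h (\<psi> \<theta>) \<partial>?M"] ballI)
    fix a assume a: "a \<in> rep ` S"
    then have aS: "a \<in> S" using rep_cell by auto
    let ?L = "discrete_loss \<psi> P (\<lambda>_. B) (\<lambda>_. rep) l e"
    have L: "?L \<theta> a = h (\<psi> \<theta>) - indicator (\<psi> -` B a \<inter> space ?M) \<theta> * h a" if "\<theta> \<in> space ?M" for \<theta>
      using discrete_loss_split[OF a, where P = P and e = e and \<theta> = \<theta> and \<psi> = \<psi>]
        measurable_space[OF \<psi> that] that spS
      unfolding h_def by (simp add: indicator_def)
    have set: "\<psi> -` B a \<inter> space ?M \<in> sets ?M"
      using \<psi> cell_sets[OF aS] by (rule measurable_sets)
    have "(\<lambda>\<theta>. h (\<psi> \<theta>) - indicator (\<psi> -` B a \<inter> space ?M) \<theta> * h a) \<in> borel_measurable ?M"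
      using h_int set by measurable
    then have "(\<lambda>\<theta>. ?L \<theta> a) \<in> borel_measurable ?M"
      using L by (subst measurable_cong) auto
    then have Lm: "(\<lambda>\<theta>. ?L \<theta> a) \<in> borel_measurable ?V"
      by (simp add: posterior_measure_def)
    have "posterior_risk \<Theta> f p ?L x a = (\<integral>\<theta>. ?L \<theta> a \<partial>?M)"
      unfolding posterior_risk_def posterior_measure_def
      using Lm posterior_density_measurable[OF model x] posterior_density_nonneg[OF model x] spV
      by (subst integral_density) (auto simp: mult.commute)
    also have "\<dots> = (\<integral>\<theta>. h (\<psi> \<theta>) - indicator (\<psi> -` B a \<inter> space ?M) \<theta> * h a \<partial>?M)"
      using L by (intro Bochner_Integration.integral_cong) auto
    also have "\<dots> = (\<integral>\<theta>. h (\<psi> \<theta>) \<partial>?M) - measure ?M (\<psi> -` B a \<inter> space ?M) * h a"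
      using h_int set by (subst Bochner_Integration.integral_diff) (auto simp: M.emeasure_eq_measure)
    also have "measure ?M (\<psi> -` B a \<inter> space ?M) = measure (marginal ?M S \<psi>) (B a)"
      unfolding marginal_def using \<psi> cell_sets[OF aS] by (subst measure_distr) auto
    finally show "posterior_risk \<Theta> f p ?L x a =
        (\<integral>\<theta>. h (\<psi> \<theta>) \<partial>?M) - measure (marginal ?M S \<psi>) (B a) / max e (measure P (B a))"
      by (simp add: h_def)
  qed
qed

end

section \<open>Convergence of the Bayes rules\<close>

lemma cells_eventually_small:
  assumes reg: "regular_discretization S P r B" and "0 < (d::real)"
  shows "eventually (\<lambda>l. \<forall>y\<in>S. \<forall>z\<in>B l y. dist y z < d) (at_right 0)"
proof -
  have lim: "((\<lambda>l. SUP y\<in>S. ediameter (B l y)) \<longlongrightarrow> 0) (at_right 0)"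
    and inn: "\<And>l y. 0 < l \<Longrightarrow> y \<in> S \<Longrightarrow> y \<in> B l y"
    using reg unfolding regular_discretization_def by auto
  have "eventually (\<lambda>l. (SUP y\<in>S. ediameter (B l y)) < ereal d) (at_right 0)"
    using lim by (rule order_tendstoD) (use \<open>0 < d\<close> in simp)
  then show ?thesis using eventually_at_right_less[of "0::real"]
  proof eventually_elim
    case (elim l)
    show ?case
    proof (intro ballI)
      fix y z assume y: "y \<in> S" and z: "z \<in> B l y"
      have "ereal (dist y z) \<le> ediameter (B l y)"
        unfolding ediameter_def using inn[OF elim(2) y] z by (intro SUP_upper2[of "(y, z)"]) auto
      also have "\<dots> \<le> (SUP y\<in>S. ediameter (B l y))" using y by (intro SUP_upper)
      finally have "ereal (dist y z) < ereal d" using elim(1) by (rule le_less_trans)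
      then show "dist y z < d" by simp
    qed
  qed
qed

theorem theorem6:
  fixes \<Theta> :: "'t::euclidean_space set"
    and X :: "'x::euclidean_space set"
    and S :: "'p::euclidean_space set"
    and f :: "'t \<Rightarrow> 'x \<Rightarrow> real"
    and p :: "'t \<Rightarrow> real"
    and \<psi> :: "'t \<Rightarrow> 'p"
    and r :: "'p \<Rightarrow> real"
    and q :: "'x \<Rightarrow> 'p \<Rightarrow> real"
    and B :: "real \<Rightarrow> 'p \<Rightarrow> 'p set"
    and rep :: "real \<Rightarrow> 'p \<Rightarrow> 'p"
  assumes model: "bayes_model \<Theta> X f p"
    and target: "open S"
    and prior_density: "marginal_density (prior_measure \<Theta> p) S \<psi> r"
    and post_density: "\<And>x. x \<in> X \<Longrightarrow> marginal_density (posterior_measure \<Theta> p f x) S \<psi> (q x)"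
    and post_cont: "\<And>x. x \<in> X \<Longrightarrow> continuous_on S (q x)"
    and prior_pos: "\<And>y. y \<in> S \<Longrightarrow> 0 < r y"
    and prior_cont: "continuous_on S r"
    and regular: "regular_discretization S (marginal (prior_measure \<Theta> p) S \<psi>) r B"
    and reps: "cell_representatives S B rep"
    and lrse_unique: "\<And>x. x \<in> X \<Longrightarrow> \<exists>!y. is_arg_max (relative_belief r q x) (\<lambda>y. y \<in> S) y"
    and lrse_sep: "\<And>x \<epsilon>. x \<in> X \<Longrightarrow> 0 < \<epsilon> \<Longrightarrow>
      (SUP y\<in>{y \<in> S. norm (y - lrse S r q x) \<ge> \<epsilon>}. ereal (relative_belief r q x y))
        < ereal (relative_belief r q x (lrse S r q x))"
  shows "\<exists>\<eta> :: real \<Rightarrow> real. (\<forall>l>0. 0 < \<eta> l) \<and>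
    (\<exists>\<delta>. \<forall>l>0. bayes_rule \<Theta> X f p (rep l ` S)
       (discrete_loss \<psi> (marginal (prior_measure \<Theta> p) S \<psi>) B rep l (\<eta> l)) (\<delta> l)) \<and>
    (\<forall>\<delta>. (\<forall>l>0. bayes_rule \<Theta> X f p (rep l ` S)
            (discrete_loss \<psi> (marginal (prior_measure \<Theta> p) S \<psi>) B rep l (\<eta> l)) (\<delta> l)) \<longrightarrow>
       (\<forall>x\<in>X. ((\<lambda>l. \<delta> l x) \<longlongrightarrow> lrse S r q x) (at_right 0)))"
proof -
  let ?P = "marginal (prior_measure \<Theta> p) S \<psi>"
  let ?Q = "\<lambda>x. marginal (posterior_measure \<Theta> p f x) S \<psi>"
  have cells: "cell_partition S (B l) (rep l)" if "0 < l" for l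
  proof -
    have "countable (B l ` S) \<and> partition_on S (B l ` S) \<and>
        (\<forall>y\<in>S. y \<in> B l y \<and> B l y \<in> sets (volume_on S))"
      using regular that unfolding regular_discretization_def by blast
    moreover have "\<forall>y\<in>S. rep l y \<in> B l y \<and> (\<forall>z\<in>B l y. rep l z = rep l y)"
      using reps that unfolding cell_representatives_def by blast
    ultimately show ?thesis by unfold_locales blast+
  qed
  have mass: "0 < measure ?P (B l y)" if "0 < l" "y \<in> S" for l y
    using regular that unfolding regular_discretization_def by auto
  have "\<exists>\<eta> :: real \<Rightarrow> real. (\<forall>l>0. 0 < \<eta> l) \<and> (\<forall>y\<in>S. \<forall>e>0.
      eventually (\<lambda>l. \<exists>z\<in>S. dist z y < e \<and> \<eta> l \<le> measure ?P (B l z)) (at_right 0))"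
    by (rule exists_mass_floor_near_every_point[OF mass])
  then obtain \<eta> :: "real \<Rightarrow> real" where \<eta>_pos: "\<forall>l>0. 0 < \<eta> l"
    and floor: "\<forall>y\<in>S. \<forall>e>0.
      eventually (\<lambda>l. \<exists>z\<in>S. dist z y < e \<and> \<eta> l \<le> measure ?P (B l z)) (at_right 0)"
    by (elim exE conjE)
  have \<eta>: "0 < \<eta> l" if "0 < l" for l using \<eta>_pos that by blast
  \<comment> \<open>\<open>G\<close> is the truncated ratio that a Bayes rule maximizes.\<close>
  define L where "L l = discrete_loss \<psi> ?P B rep l (\<eta> l)" for l
  define G where "G l x a = measure (?Q x) (B l a) / max (\<eta> l) (measure ?P (B l a))" for l x a
  have \<psi>: "\<psi> \<in> measurable (posterior_measure \<Theta> p f x) (volume_on S)" if "x \<in> X" for x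
    using post_density[OF that] by (simp add: marginal_density_def distributed_def)
  have \<psi>0: "\<psi> \<in> measurable (prior_measure \<Theta> p) (volume_on S)"
    using prior_density by (simp add: marginal_density_def distributed_def)
  have finQ: "finite_measure (?Q x)" if "x \<in> X" for x
    using prob_space.prob_space_distr[OF prob_space_posterior[OF model that] \<psi>[OF that]]
    unfolding marginal_def by (rule prob_space.finite_measure)
  have finP: "finite_measure ?P"
    using prob_space.prob_space_distr[OF _ \<psi>0] model
    unfolding marginal_def bayes_model_def by (blast intro: prob_space.finite_measure)
  have bayes_iff: "is_arg_min (posterior_risk \<Theta> f p (L l) x) (\<lambda>a. a \<in> rep l ` S) a \<longleftrightarrow>
      a \<in> rep l ` S \<and> (\<forall>b\<in>rep l ` S. G l x b \<le> G l x a)" if l: "0 < l" and x: "x \<in> X" for l x a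
  proof -
    interpret cell_partition S "B l" "rep l" by (rule cells[OF l])
    have "L l = discrete_loss \<psi> ?P (\<lambda>_. B l) (\<lambda>_. rep l) l (\<eta> l)"
      by (simp add: L_def discrete_loss_def discrete_prior_def fun_eq_iff)
    then obtain K where "\<forall>a\<in>rep l ` S. posterior_risk \<Theta> f p (L l) x a = K - G l x a"
      using posterior_risk_split[OF model x \<eta>[OF l] \<psi>[OF x], where l = l and P = ?P]
      unfolding G_def by auto
    then show ?thesis by (auto simp: is_arg_min_linorder)
  qed
  have ex: "\<exists>a. is_arg_min (posterior_risk \<Theta> f p (L l) x) (\<lambda>a. a \<in> rep l ` S) a"
    if l: "0 < l" and x: "x \<in> X" for l x
  proof -
    interpret cell_partition S "B l" "rep l" by (rule cells[OF l])
    have "S \<noteq> {}" using lrse_unique[OF x] by (auto simp: is_arg_max_def)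
    moreover have "B l ` S \<subseteq> sets (?Q x)" using cell_sets by (auto simp: marginal_def)
    ultimately obtain y where y: "y \<in> S"
      and best: "\<And>z. z \<in> S \<Longrightarrow> G l x z \<le> G l x y"
      using exists_max_truncated_ratio[OF finQ[OF x], of "B l ` S" "\<eta> l" "measure ?P"] partition \<eta>[OF l]
      unfolding partition_on_def G_def by auto
    have "is_arg_min (posterior_risk \<Theta> f p (L l) x) (\<lambda>a. a \<in> rep l ` S) (rep l y)"
      unfolding bayes_iff[OF l x] using y best rep_cell[OF y] rep_cell by (auto simp: G_def)
    then show ?thesis ..
  qed
  have conv: "((\<lambda>l. \<delta> l x) \<longlongrightarrow> lrse S r q x) (at_right 0)"
    if \<delta>: "\<And>l. 0 < l \<Longrightarrow> bayes_rule \<Theta> X f p (rep l ` S) (L l) (\<delta> l)" and x: "x \<in> X" for \<delta> x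
  proof (rule tendstoI)
    fix e :: real assume e: "0 < e"
    let ?y = "lrse S r q x" and ?rb = "relative_belief r q x"
    have y: "?y \<in> S"
    proof -
      have "is_arg_max ?rb (\<lambda>y. y \<in> S) ?y"
        unfolding lrse_def arg_max_on_def arg_max_def
        by (rule someI_ex[OF ex1_implies_ex[OF lrse_unique[OF x]]])
      then show ?thesis by (simp add: is_arg_max_def)
    qed
    \<comment> \<open>The radius \<open>e / 2\<close> leaves room for the diameter of a cell that contains a point at
      distance at least \<open>e\<close> from the maximizer.\<close>
    obtain s :: real where s: "(SUP y\<in>{y \<in> S. norm (y - ?y) \<ge> e / 2}. ereal (?rb y)) < ereal s"
      "ereal s < ereal (?rb ?y)"
      using ereal_dense2[OF lrse_sep[OF x, of "e / 2"]] e by (meson half_gt_zero)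
    have far: "?rb z < s" if "z \<in> S" "e / 2 \<le> dist z ?y" for z
    proof -
      have "ereal (?rb z) \<le> (SUP y\<in>{y \<in> S. norm (y - ?y) \<ge> e / 2}. ereal (?rb y))"
        using that by (intro SUP_upper) (simp add: dist_norm)
      then have "ereal (?rb z) < ereal s" using s(1) by (rule le_less_trans)
      then show ?thesis by simp
    qed
    obtain c where c: "s < c" "c < ?rb ?y" using dense[of s "?rb ?y"] s(2) by (meson less_ereal.simps(1))
    have "continuous_on S ?rb"
      unfolding relative_belief_def using prior_pos post_cont[OF x] prior_cont
      by (intro continuous_on_divide) (auto simp: less_imp_neq[symmetric])
    then have "isCont ?rb ?y" using target y by (simp add: continuous_on_eq_continuous_at)
    then have "eventually (\<lambda>z. c < ?rb z) (nhds ?y)"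
      using c(2) by (auto simp: isCont_def tendsto_at_iff_tendsto_nhds dest: order_tendstoD(1))
    then obtain d where d: "0 < d" and near: "\<And>z. dist z ?y < d \<Longrightarrow> c < ?rb z"
      unfolding eventually_nhds_metric by blast
    have dens: "?P = density (volume_on S) (\<lambda>y. ennreal (r y))"
        "?Q x = density (volume_on S) (\<lambda>y. ennreal (q x y))"
      and dens_meas: "(\<lambda>y. ennreal (r y)) \<in> borel_measurable (volume_on S)"
        "(\<lambda>y. ennreal (q x y)) \<in> borel_measurable (volume_on S)"
      and q_nonneg: "\<And>y. y \<in> S \<Longrightarrow> 0 \<le> q x y"
      using prior_density post_density[OF x]
      unfolding marginal_density_def distributed_def marginal_def by auto
    have "eventually (\<lambda>l. \<exists>z\<in>S. dist z ?y < d / 2 \<and> \<eta> l \<le> measure ?P (B l z)) (at_right 0)"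
      by (rule floor[rule_format, OF y]) (use d in simp)
    moreover have "eventually (\<lambda>l. \<forall>y\<in>S. \<forall>z\<in>B l y. dist y z < min (d / 2) (e / 2)) (at_right 0)"
      by (rule cells_eventually_small[OF regular]) (use d e in simp)
    ultimately show "eventually (\<lambda>l. dist (\<delta> l x) ?y < e) (at_right 0)"
      using eventually_at_right_less[of "0::real"]
    proof eventually_elim
      case (elim l)
      interpret cell_partition S "B l" "rep l" by (rule cells) (use elim in simp)
      define a where "a = \<delta> l x"
      \<comment> \<open>The cell of \<open>z\<close> competes with the selected cell: it is heavy enough to escape the
        truncation and lies in the ball of radius \<open>d\<close> around the maximizer.\<close>
      obtain z where z: "z \<in> S" "dist z ?y < d / 2" "\<eta> l \<le> measure ?P (B l z)" using elim by blast
      have arg: "is_arg_min (posterior_risk \<Theta> f p (L l) x) (\<lambda>a. a \<in> rep l ` S) a"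
        using \<delta> elim(3) x unfolding bayes_rule_def a_def by auto
      have aS: "a \<in> S" using arg rep_cell unfolding bayes_iff[OF elim(3) x] by auto
      have Gz: "G l x z \<le> G l x a"
        using arg z rep_cell[OF z(1)] unfolding bayes_iff[OF elim(3) x] by (auto simp: G_def)
      show ?case
      proof (rule ccontr)
        assume "\<not> ?case"
        then have ae: "e \<le> dist a ?y" by (simp add: a_def)
        have upper: "q x u < s * r u" if "u \<in> B l a" for u
        proof -
          have "u \<in> S" using that aS cell_subset by auto
          moreover have "dist a u < e / 2" using elim(2) aS that by auto
          then have "e / 2 \<le> dist u ?y" using ae dist_triangle[of a ?y u] by linarith
          ultimately show ?thesis
            using far[of u] prior_pos[of u] by (auto simp: relative_belief_def field_simps)
        qed
        \<comment> \<open>The separation bound alone does not give a sign: if no point of \<open>S\<close> is far from the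
          maximizer, the supremum is \<open>-\<infinity>\<close> and \<open>s\<close> may be negative. Here \<open>a\<close> is such a point.\<close>
        have "0 \<le> s"
        proof -
          have "0 < s * r a" using upper[OF in_cell[OF aS]] q_nonneg[OF aS] by linarith
          then show ?thesis using prior_pos[OF aS] by (simp add: zero_less_mult_iff)
        qed
        have lower: "r u \<le> 1 / c * q x u" if "u \<in> B l z" for u
        proof -
          have "u \<in> S" using that z cell_subset by auto
          moreover have "dist z u < d / 2" using elim(2) z that by auto
          then have "dist u ?y < d"
            using z(2) dist_triangle[of u ?y z] by (simp add: dist_commute)
          ultimately show ?thesis
            using near[of u] prior_pos[of u] \<open>0 \<le> s\<close> c
            by (auto simp: relative_belief_def field_simps)
        qed
        have "measure (?Q x) (B l a) \<le> s * measure ?P (B l a)"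
          by (rule measure_density_le_mult[OF dens finP finQ[OF x] dens_meas cell_sets[OF aS] \<open>0 \<le> s\<close>])
            (rule less_imp_le[OF upper])
        then have "measure (?Q x) (B l a) \<le> s * max (\<eta> l) (measure ?P (B l a))"
          using \<open>0 \<le> s\<close> by (meson max.cobounded2 mult_left_mono order_trans)
        then have "G l x a \<le> s"
          using \<eta>[OF elim(3)] unfolding G_def by (auto simp: divide_le_eq)
        moreover have "measure ?P (B l z) \<le> 1 / c * measure (?Q x) (B l z)"
          by (rule measure_density_le_mult[OF dens(2,1) finQ[OF x] finP dens_meas(2,1) cell_sets[OF z(1)] _ lower])
            (use \<open>0 \<le> s\<close> c in auto)
        then have "c \<le> G l x z"
          using z(3) mass[OF elim(3) z(1)] \<open>0 \<le> s\<close> c unfolding G_def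
          by (simp add: field_simps max_absorb2)
        ultimately show False using Gz c by linarith
      qed
    qed
  qed
  have "\<forall>l>0. bayes_rule \<Theta> X f p (rep l ` S) (L l)
      (\<lambda>x. SOME a. is_arg_min (posterior_risk \<Theta> f p (L l) x) (\<lambda>a. a \<in> rep l ` S) a)"
    unfolding bayes_rule_def by (intro allI impI ballI) (rule someI_ex[OF ex])
  then have "\<exists>\<delta>. \<forall>l>0. bayes_rule \<Theta> X f p (rep l ` S) (L l) (\<delta> l)"
    by (rule exI[of _ "\<lambda>l x. SOME a. is_arg_min (posterior_risk \<Theta> f p (L l) x) (\<lambda>a. a \<in> rep l ` S) a"])
  moreover have "\<forall>\<delta>. (\<forall>l>0. bayes_rule \<Theta> X f p (rep l ` S) (L l) (\<delta> l)) \<longrightarrow>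
      (\<forall>x\<in>X. ((\<lambda>l. \<delta> l x) \<longlongrightarrow> lrse S r q x) (at_right 0))"
    by (intro allI impI ballI conv) (erule allE, erule mp, assumption)
  ultimately show ?thesis
    using \<eta>_pos unfolding L_def by (intro exI[of _ \<eta>] conjI)
qed

end
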